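(* Let $\alpha\in\mathbb{R}$, $\alpha\neq 0,1$, let $s,k\in\mathbb{R}$ and let $\epsilon>0$. (a) If $s-k>\frac12$ or $k<-\frac12$, then the bilinear estimate $$\|uv\|_{L^2(\mathbb{R}^2)}\lesssim \|u\|_{X^{\alpha}_{k-s-\frac12,\frac12+\epsilon}}\|v\|_{X_{s,\frac12+\epsilon}}$$ fails to hold. (b) If $k-s>\frac12$ or $s<-\frac12$, then the bilinear estimate $$\|uv\|_{L^2(\mathbb{R}^2)}\lesssim \|u\|_{X_{s-k-\frac12,\frac12+\epsilon}}\|v\|_{X^{\alpha}_{k,\frac12+\epsilon}}$$ fails to hold.
   Context: Write $\langle\cdot\rangle:=1+|\cdot|$ and let $\tilde f(\tau,\xi)$ denote the space-time Fourier transform of $f(t,x)$. For $s,b\in\mathbb{R}$, $X^{\alpha}_{s,b}$ is the completion of the Schwartz class $\mathcal{S}(\mathbb{R}^2)$ under the norm $$\|f\|_{X^{\alpha}_{s,b}}:=\|\langle\xi\rangle^s\langle\tau-\alpha\xi^3\rangle^b\tilde f(\tau,\xi)\|_{L^2_{\tau,\xi}},$$ and $X_{s,b}:=X^1_{s,b}$. An estimate $A\lesssim B$ "holds" if there is a constant $C>0$, independent of the functions involved, such that $A\le CB$ for all (Schwartz) functions; it "fails to hold" if no such constant exists. *)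

theory Defs
  imports "HOL-Analysis.Analysis"
begin

definition partial_deriv :: "real \<times> real \<Rightarrow> (real \<times> real \<Rightarrow> complex) \<Rightarrow> real \<times> real \<Rightarrow> complex" where
  "partial_deriv b f = (\<lambda>z. frechet_derivative f (at z) b)"

(* Schwartz class S(R^2), complex-valued.  A list over Basis = {(1,0), (0,1)} is a word of partial
   derivatives; differentiability of f after every such word is smoothness. *)
definition schwartz :: "(real \<times> real \<Rightarrow> complex) \<Rightarrow> bool" where
  "schwartz f \<longleftrightarrow>
     (\<forall>bs \<in> lists Basis.
        (\<forall>z. foldr partial_deriv bs f differentiable (at z)) \<and>
        (\<forall>n::nat. bounded (range (\<lambda>z. norm z ^ n *\<^sub>R foldr partial_deriv bs f z))))"

(* Points of physical space are (t, x), points of frequency space are (tau, xi).  Angular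
   frequencies, no prefactor: the integral of exp (-i (t tau + x xi)) f (t, x) dt dx. *)
definition fourier :: "(real \<times> real \<Rightarrow> complex) \<Rightarrow> real \<times> real \<Rightarrow> complex" where
  "fourier f = (\<lambda>(\<tau>, \<xi>). LINT (t, x)|lborel. cis (- (t * \<tau> + x * \<xi>)) * f (t, x))"

definition bracket :: "real \<Rightarrow> real" where
  "bracket x = 1 + \<bar>x\<bar>"

(* The L^2 norms take values in [0, infinity], so that a divergent integral is infinite
   rather than 0; hence the square root has to be extended by sqrt infinity = infinity. *)
definition sqrt_ennreal :: "ennreal \<Rightarrow> ennreal" where
  "sqrt_ennreal a = (if a = \<infinity> then \<infinity> else ennreal (sqrt (enn2real a)))"

definition L2_norm :: "(real \<times> real \<Rightarrow> complex) \<Rightarrow> ennreal" where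
  "L2_norm f = sqrt_ennreal (\<integral>\<^sup>+ z. ennreal ((norm (f z))\<^sup>2) \<partial>lborel)"

definition X_norm :: "real \<Rightarrow> real \<Rightarrow> real \<Rightarrow> (real \<times> real \<Rightarrow> complex) \<Rightarrow> ennreal" where
  "X_norm \<alpha> s b f =
     L2_norm (\<lambda>(\<tau>, \<xi>). complex_of_real (bracket \<xi> powr s * bracket (\<tau> - \<alpha> * \<xi> ^ 3) powr b)
                          * fourier f (\<tau>, \<xi>))"

definition L2_bilinear_estimate ::
  "((real \<times> real \<Rightarrow> complex) \<Rightarrow> ennreal) \<Rightarrow> ((real \<times> real \<Rightarrow> complex) \<Rightarrow> ennreal) \<Rightarrow> bool" where
  "L2_bilinear_estimate N1 N2 \<longleftrightarrow>
     (\<exists>C::real. C > 0 \<and>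
        (\<forall>u v. schwartz u \<longrightarrow> schwartz v \<longrightarrow>
           L2_norm (\<lambda>z. u z * v z) \<le> ennreal C * (N1 u * N2 v)))"

end

theory Submission
  imports Defs "HOL-Probability.Probability" "HOL-Real_Asymp.Real_Asymp"
begin

text \<open>
  Both halves of the theorem are instances of one fact: an estimate of \<open>u v\<close> in \<open>L\<^sup>2\<close> by the product of
  two \<open>X\<close> norms, with Sobolev exponents \<open>p\<close> on \<open>u\<close> and \<open>q\<close> on \<open>v\<close>, fails as soon as \<open>p < -1\<close> or
  \<open>p + q < -1\<close>.  In part (a), \<open>p = k - s - 1/2\<close> and \<open>q = s\<close>, so these two conditions read
  \<open>s - k > 1/2\<close> and \<open>k < -1/2\<close>; part (b) is the same with \<open>s\<close> and \<open>k\<close> exchanged.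

  Near frequency \<open>\<xi> = M\<close> with \<open>0 \<le> M \<le> N\<close>, the curve \<open>\<tau> = a \<xi>\<^sup>3\<close> has slope \<open>O(N\<^sup>2)\<close>.  A box around the
  point \<open>(a M\<^sup>3, M)\<close> of height \<open>1\<close> in \<open>\<tau>\<close> and width \<open>N\<^sup>-\<^sup>2\<close> in \<open>\<xi>\<close> therefore stays within distance \<open>O(1)\<close>
  of the curve.  On such a box the modulation weight is harmless and
  the frequency weight is comparable to that power of \<open>\<langle>M\<rangle>\<close> which
  the Sobolev exponent prescribes.  The corresponding function in physical space
  has modulus of order one on a box of size \<open>1 \<times> N\<^sup>2\<close>; its \<open>X\<close> norm with Sobolev exponent \<open>p\<close> is
  thus \<open>O(N \<langle>M\<rangle>\<^sup>p)\<close>.  The product of two of them lives on the same box in physical space, wherever the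
  two frequency boxes lie, so its norm is of order \<open>N\<close>.  With \<open>u\<close> at frequency \<open>N\<close> and \<open>v\<close> at
  frequency \<open>M\<close>, the estimate would give \<open>1 \<lesssim> N \<langle>N\<rangle>\<^sup>p \<langle>M\<rangle>\<^sup>q\<close>.  Letting \<open>N\<close> tend to infinity, \<open>M = 0\<close>
  contradicts this if \<open>p < -1\<close>, and \<open>M = N\<close> if \<open>p + q < -1\<close>.

  Modulated Gaussians serve as the test functions: they are Schwartz functions, their Fourier
  transforms are again Gaussians in closed form (lemma \<open>fourier_packet\<close>), and their tails absorb the
  polynomial growth of the weights away from the box (lemma \<open>weight_le_gaussian\<close>).  The two resulting
  norm bounds are \<open>X_norm_packet\<close> and \<open>L2_norm_packet_product\<close>.
\<close>

section \<open>Functions of Gaussian decay in the Schwartz class\<close>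

text \<open>Complex polynomial functions on the plane.  Membership in the Schwartz class only needs
  that they are closed under differentiation and grow polynomially, and both follow by rule induction.\<close>

inductive poly2 :: "(real \<times> real \<Rightarrow> complex) \<Rightarrow> bool" where
  const: "poly2 (\<lambda>z. c)"
| fst: "poly2 (\<lambda>z. complex_of_real (fst z))"
| snd: "poly2 (\<lambda>z. complex_of_real (snd z))"
| add: "poly2 P \<Longrightarrow> poly2 Q \<Longrightarrow> poly2 (\<lambda>z. P z + Q z)"
| mult: "poly2 P \<Longrightarrow> poly2 Q \<Longrightarrow> poly2 (\<lambda>z. P z * Q z)"

lemma poly2_has_derivative:
  assumes "poly2 P"
  shows "\<exists>D. (\<forall>z. (P has_derivative D z) (at z)) \<and> (\<forall>b. poly2 (\<lambda>z. D z b))"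
  using assms
proof induction
  case (const c)
  show ?case
    by (rule exI[of _ "\<lambda>z b. 0"]) (auto intro: poly2.intros)
next
  case fst
  show ?case
    by (rule exI[of _ "\<lambda>z b. complex_of_real (fst b)"])
      (auto intro!: poly2.const derivative_eq_intros)
next
  case snd
  show ?case
    by (rule exI[of _ "\<lambda>z b. complex_of_real (snd b)"])
      (auto intro!: poly2.const derivative_eq_intros)
next
  case (add P Q)
  then obtain D E where
    "\<forall>z. (P has_derivative D z) (at z)" "\<forall>b. poly2 (\<lambda>z. D z b)"
    "\<forall>z. (Q has_derivative E z) (at z)" "\<forall>b. poly2 (\<lambda>z. E z b)"
    by blast
  then show ?case
    by (intro exI[of _ "\<lambda>z b. D z b + E z b"]) (auto intro: poly2.intros has_derivative_add)
next
  case (mult P Q)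
  then obtain D E where
    "\<forall>z. (P has_derivative D z) (at z)" "\<forall>b. poly2 (\<lambda>z. D z b)"
    "\<forall>z. (Q has_derivative E z) (at z)" "\<forall>b. poly2 (\<lambda>z. E z b)"
    by blast
  with mult.hyps show ?case
    by (intro exI[of _ "\<lambda>z b. P z * E z b + D z b * Q z"] conjI allI
        has_derivative_mult poly2.add poly2.mult) blast+
qed

lemma poly2_growth:
  assumes "poly2 P"
  shows "\<exists>K\<ge>0. \<exists>m. \<forall>z. norm (P z) \<le> K * (1 + norm z) ^ m"
  using assms
proof induction
  case (const c)
  show ?case by (intro exI[of _ "norm c"] conjI exI[of _ 0]) auto
next
  case fst
  show ?case
    using norm_fst_le
    by (intro exI[of _ 1] conjI exI[of _ 1]) (auto intro!: add_increasing simp: norm_Pair)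
next
  case snd
  show ?case
    using norm_snd_le
    by (intro exI[of _ 1] conjI exI[of _ 1]) (auto intro!: add_increasing simp: norm_Pair)
next
  case (add P Q)
  then obtain K m L n where K: "K \<ge> 0" "\<And>z. norm (P z) \<le> K * (1 + norm z) ^ m"
    and L: "L \<ge> 0" "\<And>z. norm (Q z) \<le> L * (1 + norm z) ^ n"
    by blast
  have "norm (P z + Q z) \<le> (K + L) * (1 + norm z) ^ (m + n)" for z
  proof -
    have "norm (P z) \<le> K * (1 + norm z) ^ (m + n)"
      by (rule order_trans[OF K(2)]) (intro mult_left_mono power_increasing K, auto)
    moreover have "norm (Q z) \<le> L * (1 + norm z) ^ (m + n)"
      by (rule order_trans[OF L(2)]) (intro mult_left_mono power_increasing L, auto)
    ultimately show ?thesis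
      using norm_triangle_ineq[of "P z" "Q z"] by (simp add: algebra_simps)
  qed
  with K L show ?case by (intro exI[of _ "K + L"] conjI exI[of _ "m + n"]) auto
next
  case (mult P Q)
  then obtain K m L n where K: "K \<ge> 0" "\<And>z. norm (P z) \<le> K * (1 + norm z) ^ m"
    and L: "L \<ge> 0" "\<And>z. norm (Q z) \<le> L * (1 + norm z) ^ n"
    by blast
  have "norm (P z * Q z) \<le> (K * L) * (1 + norm z) ^ (m + n)" for z
    using mult_mono[OF K(2)[of z] L(2)[of z]] K(1)
    by (simp add: norm_mult power_add mult_ac)
  with K L show ?case by (intro exI[of _ "K * L"] conjI exI[of _ "m + n"]) auto
qed

text \<open>The arithmetic-geometric mean inequality; it lets a Gaussian beat any exponential, and hence, by
  \<open>1 + r \<le> exp r\<close>, any power.\<close>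

lemma linear_le_square:
  fixes m d r :: real
  assumes "d > 0"
  shows "m * r \<le> d * r\<^sup>2 + m\<^sup>2 / (4 * d)"
proof -
  have "d * r\<^sup>2 + m\<^sup>2 / (4 * d) - m * r = (2 * d * r - m)\<^sup>2 / (4 * d)"
    using assms by (simp add: field_simps power2_eq_square)
  then show ?thesis using assms
    by (smt (verit) divide_nonneg_pos zero_le_power2)
qed

text \<open>The products of \<open>G\<close> with polynomials form a class that is closed under partial derivatives, because
  the logarithmic derivative \<open>E\<close> of \<open>G\<close> is a polynomial.  Every function in the class decays rapidly.\<close>

lemma schwartz_of_gaussian_decay:
  fixes G :: "real \<times> real \<Rightarrow> complex"
  assumes deriv: "\<And>z. (G has_derivative (\<lambda>h. E z h * G z)) (at z)"
    and E: "\<And>b. poly2 (\<lambda>z. E z b)"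
    and decay: "d > 0" "\<And>z. norm (G z) \<le> exp (- d * (norm z)\<^sup>2)"
  shows "schwartz G"
proof -
  define F where "F = {\<lambda>z. P z * G z | P. poly2 P}"
  have F_deriv: "(\<forall>z. f differentiable (at z)) \<and> partial_deriv b f \<in> F" if "f \<in> F" for f b
  proof -
    from that obtain P where P: "poly2 P" and f: "f = (\<lambda>z. P z * G z)"
      unfolding F_def by blast
    obtain D where D: "\<And>z. (P has_derivative D z) (at z)" "\<And>b. poly2 (\<lambda>z. D z b)"
      using poly2_has_derivative[OF P] by blast
    have der: "(f has_derivative (\<lambda>h. P z * (E z h * G z) + D z h * G z)) (at z)" for z
      unfolding f by (rule has_derivative_mult[OF D(1) deriv])
    have "partial_deriv b f = (\<lambda>z. (P z * E z b + D z b) * G z)"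
      unfolding partial_deriv_def frechet_derivative_at[OF der, symmetric]
      by (simp add: algebra_simps)
    moreover have "poly2 (\<lambda>z. P z * E z b + D z b)"
      by (intro poly2.add poly2.mult P E D)
    ultimately have "partial_deriv b f \<in> F"
      unfolding F_def by (intro CollectI exI[of _ "\<lambda>z. P z * E z b + D z b"]) simp
    with der show ?thesis
      unfolding differentiable_def by blast
  qed
  have F_iter: "foldr partial_deriv bs G \<in> F" for bs
  proof (induction bs)
    case Nil
    show ?case unfolding F_def using poly2.const[of 1] by force
  qed (use F_deriv in auto)
  have F_decay: "bounded (range (\<lambda>z. norm z ^ n *\<^sub>R f z))" if "f \<in> F" for f n
  proof -
    from that obtain P where P: "poly2 P" and f: "f = (\<lambda>z. P z * G z)"
      unfolding F_def by blast
    obtain K m where K: "K \<ge> 0" "\<And>z. norm (P z) \<le> K * (1 + norm z) ^ m"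
      using poly2_growth[OF P] by blast
    define l where "l = real (n + m)"
    have "norm (norm z ^ n *\<^sub>R f z) \<le> K * exp (l\<^sup>2 / (4 * d))" for z
    proof -
      have 1: "norm (norm z ^ n *\<^sub>R f z) = norm z ^ n * (norm (P z) * norm (G z))"
        by (simp add: f norm_mult)
      have 2: "\<dots> \<le> (1 + norm z) ^ n * ((K * (1 + norm z) ^ m) * exp (- d * (norm z)\<^sup>2))"
        by (intro mult_mono power_mono K decay) (auto simp: K)
      have 3: "\<dots> = K * ((1 + norm z) ^ (n + m) * exp (- d * (norm z)\<^sup>2))"
        by (simp add: power_add)
      have "(1 + norm z) ^ (n + m) \<le> exp (norm z) ^ (n + m)"
        by (intro power_mono exp_ge_add_one_self) auto
      also have "\<dots> = exp (l * norm z)"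
        by (simp add: l_def exp_of_nat_mult[symmetric])
      finally have "(1 + norm z) ^ (n + m) * exp (- d * (norm z)\<^sup>2)
          \<le> exp (l * norm z) * exp (- d * (norm z)\<^sup>2)"
        by (intro mult_right_mono) auto
      also have "\<dots> \<le> exp (l\<^sup>2 / (4 * d))"
        using linear_le_square[OF decay(1), of l "norm z"] by (simp add: exp_add[symmetric])
      finally show ?thesis
        unfolding 1 by (intro order_trans[OF 2] order_trans[OF eq_refl[OF 3]] mult_left_mono K)
    qed
    then show ?thesis unfolding bounded_iff by blast
  qed
  show ?thesis
    unfolding schwartz_def using F_iter F_deriv F_decay by blast
qed

section \<open>Wave packets and their Fourier transforms\<close>

text \<open>A Gaussian of duration \<open>1\<close> and spatial width \<open>L\<close>, modulated so that its Fourier transform is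
  concentrated at \<open>(A, B)\<close>.  The two variables are kept in separate factors so that Fubini's theorem
  reduces the transform to one dimension.\<close>

definition packet :: "real \<Rightarrow> real \<Rightarrow> real \<Rightarrow> real \<times> real \<Rightarrow> complex" where
  "packet L A B = (\<lambda>(t, x).
     (complex_of_real (exp (- t\<^sup>2 / 2)) * cis (t * A)) *
     (complex_of_real (exp (- (x / L)\<^sup>2 / 2)) * cis (x * B)))"

lemma schwartz_packet:
  assumes "L > 0"
  shows "schwartz (packet L A B)"
proof (rule schwartz_of_gaussian_decay)
  define c where "c = complex_of_real (1 / L\<^sup>2)"
  define E :: "real \<times> real \<Rightarrow> real \<times> real \<Rightarrow> complex" where
    "E z h = ((- 1) * of_real (fst z) + \<i> * of_real A) * of_real (fst h)
           + ((- c) * of_real (snd z) + \<i> * of_real B) * of_real (snd h)" for z h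
  define g :: "real \<times> real \<Rightarrow> complex" where
    "g z = - (of_real (fst z))\<^sup>2 / 2 + \<i> * (of_real (fst z) * of_real A)
         + (- c * (of_real (snd z))\<^sup>2 / 2 + \<i> * (of_real (snd z) * of_real B))" for z
  have packet_exp: "packet L A B = (\<lambda>z. exp (g z))"
    by (auto simp: packet_def g_def c_def cis_conv_exp exp_of_real[symmetric] exp_add[symmetric]
        fun_eq_iff algebra_simps power_divide)
  have "(g has_derivative E z) (at z)" for z
    unfolding g_def by (auto intro!: derivative_eq_intros simp: E_def fun_eq_iff algebra_simps)
  then show "(packet L A B has_derivative (\<lambda>h. E z h * packet L A B z)) (at z)" for z
    unfolding packet_exp
    using has_derivative_compose[of g "E z" z UNIV exp "(*) (exp (g z))"] DERIV_exp[of "g z"]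
    by (simp add: has_field_derivative_def mult.commute)
  show "poly2 (\<lambda>z. E z b)" for b
    unfolding E_def by (intro poly2.intros)
  \<comment> \<open>The slower of the decay rates in the two directions.\<close>
  define d where "d = min (1/2) (1 / (2 * L\<^sup>2))"
  show "d > 0" using assms by (simp add: d_def)
  show "norm (packet L A B z) \<le> exp (- d * (norm z)\<^sup>2)" for z
  proof -
    obtain t x where z: "z = (t, x)" by force
    have "d * t\<^sup>2 \<le> (1/2) * t\<^sup>2" "d * x\<^sup>2 \<le> (1 / (2 * L\<^sup>2)) * x\<^sup>2"
      by (intro mult_right_mono; simp add: d_def)+
    then have "d * (norm z)\<^sup>2 \<le> t\<^sup>2 / 2 + (x / L)\<^sup>2 / 2"
      by (simp add: z norm_Pair algebra_simps power_divide)
    then show ?thesis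
      by (simp add: z packet_def norm_mult exp_add[symmetric])
  qed
qed

lemma integral_prod_mult:
  fixes f g :: "real \<Rightarrow> complex"
  assumes f: "integrable lborel f" and g: "integrable lborel g"
  shows "(LINT (t, x)|lborel. f t * g x) = (LINT t|lborel. f t) * (LINT x|lborel. g x)"
proof -
  have [measurable]: "f \<in> borel_measurable borel" "g \<in> borel_measurable borel"
    using f g by (auto dest: borel_measurable_integrable)
  have int: "integrable (lborel \<Otimes>\<^sub>M lborel) (\<lambda>(t, x). f t * g x)"
  proof (rule lborel_pair.Fubini_integrable)
    show "integrable lborel (\<lambda>t. LINT x|lborel. norm (case (t, x) of (t, x) \<Rightarrow> f t * g x))"
      using f by (simp add: norm_mult)
    show "AE t in lborel. integrable lborel (\<lambda>x. case (t, x) of (t, x) \<Rightarrow> f t * g x)"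
      using g by simp
  qed measurable
  have "(LINT (t, x)|lborel. f t * g x) = (LINT t|lborel. LINT x|lborel. f t * g x)"
    using lborel_pair.integral_fst'[OF int] by (simp add: lborel_prod)
  then show ?thesis by simp
qed

lemma std_gaussian_integrable:
  "integrable lborel (\<lambda>x. cis (x * w) * complex_of_real (exp (- x\<^sup>2 / 2)))"
proof -
  have "integrable lborel (\<lambda>x. sqrt (2 * pi) * std_normal_density x)"
    by (intro integrable_mult_right) auto
  also have "(\<lambda>x. sqrt (2 * pi) * std_normal_density x) = (\<lambda>x. exp (- x\<^sup>2 / 2))"
    by (auto simp: std_normal_density_def)
  finally have *: "integrable lborel (\<lambda>x::real. exp (- x\<^sup>2 / 2))" .
  show ?thesis
    by (rule Bochner_Integration.integrable_bound[OF *]) (auto simp: norm_mult cis_conv_exp)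
qed

text \<open>Up to normalisation this is the characteristic function of the standard normal distribution.\<close>

lemma std_gaussian_integral:
  "(LINT x|lborel. cis (x * w) * complex_of_real (exp (- x\<^sup>2 / 2)))
    = complex_of_real (sqrt (2 * pi) * exp (- w\<^sup>2 / 2))"
proof -
  have "complex_of_real (exp (- w\<^sup>2 / 2)) = char std_normal_distribution w"
    by (simp add: char_std_normal_distribution)
  also have "\<dots> = (LINT x|lborel. std_normal_density x *\<^sub>R iexp (w * x))"
    unfolding char_def by (subst integral_density) auto
  also have "\<dots> = (LINT x|lborel. complex_of_real (1 / sqrt (2 * pi)) *
       (cis (x * w) * complex_of_real (exp (- x\<^sup>2 / 2))))"
    by (intro Bochner_Integration.integral_cong)
      (auto simp: std_normal_density_def scaleR_conv_of_real cis_conv_exp mult_ac)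
  also have "\<dots> = complex_of_real (1 / sqrt (2 * pi)) *
       (LINT x|lborel. cis (x * w) * complex_of_real (exp (- x\<^sup>2 / 2)))"
    by simp
  finally show ?thesis
    by (simp add: field_simps)
qed

lemma gaussian_integral:
  assumes "L > 0"
  shows "integrable lborel (\<lambda>x. cis (x * w) * complex_of_real (exp (- (x / L)\<^sup>2 / 2)))" (is ?I)
    and "(LINT x|lborel. cis (x * w) * complex_of_real (exp (- (x / L)\<^sup>2 / 2)))
           = complex_of_real (sqrt (2 * pi) * L * exp (- (L * w)\<^sup>2 / 2))" (is ?E)
proof -
  let ?f = "\<lambda>x. cis (x * w) * complex_of_real (exp (- (x / L)\<^sup>2 / 2))"
  have *: "(\<lambda>x. ?f (0 + L * x)) = (\<lambda>x. cis (x * (L * w)) * complex_of_real (exp (- x\<^sup>2 / 2)))"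
    using assms by (auto simp: mult_ac)
  show ?I
    using lborel_integrable_real_affine_iff[of L ?f 0] std_gaussian_integrable[of "L * w"] assms
    unfolding * by simp
  show ?E
    using lborel_integral_real_affine[of L ?f 0] assms
    unfolding * std_gaussian_integral by (simp add: scaleR_conv_of_real)
qed

lemma fourier_packet:
  assumes "L > 0"
  shows "fourier (packet L A B) (\<tau>, \<xi>) =
    complex_of_real (2 * pi * L * exp (- (\<tau> - A)\<^sup>2 / 2) * exp (- (L * (\<xi> - B))\<^sup>2 / 2))"
proof -
  let ?f = "\<lambda>t. cis (t * (A - \<tau>)) * complex_of_real (exp (- (t / 1)\<^sup>2 / 2))"
  let ?g = "\<lambda>x. cis (x * (B - \<xi>)) * complex_of_real (exp (- (x / L)\<^sup>2 / 2))"
  have "cis (- (t * \<tau> + x * \<xi>)) * packet L A B (t, x) = ?f t * ?g x" for t x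
  proof -
    have "cis (- (t * \<tau> + x * \<xi>)) * (cis (t * A) * cis (x * B)) = cis (t * (A - \<tau>)) * cis (x * (B - \<xi>))"
      by (simp add: cis_mult algebra_simps)
    then show ?thesis
      by (simp add: packet_def mult_ac)
  qed
  then have "fourier (packet L A B) (\<tau>, \<xi>) = (LINT (t, x)|lborel. ?f t * ?g x)"
    by (simp add: fourier_def)
  also have "\<dots> = (LINT t|lborel. ?f t) * (LINT x|lborel. ?g x)"
    using assms by (intro integral_prod_mult gaussian_integral) auto
  also have "\<dots> = complex_of_real (sqrt (2 * pi) * 1 * exp (- (1 * (A - \<tau>))\<^sup>2 / 2))
      * complex_of_real (sqrt (2 * pi) * L * exp (- (L * (B - \<xi>))\<^sup>2 / 2))"
    using assms by (simp only: gaussian_integral zero_less_one)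
  also have "\<dots> = complex_of_real ((sqrt (2 * pi))\<^sup>2 * L * exp (- (\<tau> - A)\<^sup>2 / 2) * exp (- (L * (\<xi> - B))\<^sup>2 / 2))"
    unfolding of_real_mult[symmetric]
    by (rule arg_cong[where f = complex_of_real])
      (simp add: power2_commute[of A \<tau>] power2_commute[of B \<xi>] power_mult_distrib)
  finally show ?thesis by simp
qed

section \<open>Norms of wave packets in physical space\<close>

lemma L2_norm_le:
  assumes "c \<ge> 0" "(\<integral>\<^sup>+ z. ennreal ((norm (f z))\<^sup>2) \<partial>lborel) \<le> ennreal (c\<^sup>2)"
  shows "L2_norm f \<le> ennreal c"
proof -
  let ?I = "\<integral>\<^sup>+ z. ennreal ((norm (f z))\<^sup>2) \<partial>lborel"
  have "?I \<noteq> \<infinity>" using assms(2) by (auto simp: top_unique)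
  moreover have "sqrt (enn2real ?I) \<le> c"
    using enn2real_mono[OF assms(2)] assms(1) by (auto intro: real_le_lsqrt)
  ultimately show ?thesis
    by (simp add: L2_norm_def sqrt_ennreal_def ennreal_leI)
qed

lemma L2_norm_ge:
  assumes "c \<ge> 0" "ennreal (c\<^sup>2) \<le> (\<integral>\<^sup>+ z. ennreal ((norm (f z))\<^sup>2) \<partial>lborel)"
  shows "ennreal c \<le> L2_norm f"
proof (cases "(\<integral>\<^sup>+ z. ennreal ((norm (f z))\<^sup>2) \<partial>lborel) = \<infinity>")
  case False
  let ?I = "\<integral>\<^sup>+ z. ennreal ((norm (f z))\<^sup>2) \<partial>lborel"
  have "c \<le> sqrt (enn2real ?I)"
    using enn2real_mono[OF assms(2)] False by (auto intro: real_le_rsqrt simp: top.not_eq_extremum)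
  with False show ?thesis
    by (simp add: L2_norm_def sqrt_ennreal_def ennreal_leI)
qed (simp add: L2_norm_def sqrt_ennreal_def)

text \<open>Up to the factor \<open>sqrt (2 * pi) / L\<close>, the integrand is the normal density with mean \<open>B\<close> and standard
  deviation \<open>1 / L\<close>.\<close>

lemma nn_integral_gaussian:
  assumes "L > 0"
  shows "(\<integral>\<^sup>+ x. ennreal (exp (- (L * (x - B))\<^sup>2 / 2)) \<partial>lborel) = ennreal (sqrt (2 * pi) / L)"
proof -
  have eq: "exp (- (L * (x - B))\<^sup>2 / 2) = sqrt (2 * pi) / L * normal_density B (1 / L) x" for x
    using assms by (simp add: normal_density_def power_divide power_mult_distrib real_sqrt_divide
        mult_ac)
  have "(\<integral>\<^sup>+ x. ennreal (normal_density B (1 / L) x) \<partial>lborel) = 1"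
    using assms by (subst nn_integral_eq_integral) auto
  moreover have "ennreal (sqrt (2 * pi) / L * normal_density B (1 / L) x)
      = ennreal (sqrt (2 * pi) / L) * ennreal (normal_density B (1 / L) x)" for x
    by (rule ennreal_mult'') simp
  ultimately show ?thesis
    unfolding eq by (simp add: nn_integral_cmult)
qed

lemma nn_integral_gaussian2:
  assumes "H > 0" "L > 0"
  shows "(\<integral>\<^sup>+ (\<tau>, \<xi>). ennreal (exp (- (H * (\<tau> - A))\<^sup>2 / 2) * exp (- (L * (\<xi> - B))\<^sup>2 / 2)) \<partial>lborel)
    = ennreal (2 * pi / (H * L))"
proof -
  have "(\<integral>\<^sup>+ (\<tau>, \<xi>). ennreal (exp (- (H * (\<tau> - A))\<^sup>2 / 2) * exp (- (L * (\<xi> - B))\<^sup>2 / 2)) \<partial>lborel)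
      = (\<integral>\<^sup>+ \<tau>. \<integral>\<^sup>+ \<xi>. ennreal (exp (- (H * (\<tau> - A))\<^sup>2 / 2) * exp (- (L * (\<xi> - B))\<^sup>2 / 2)) \<partial>lborel \<partial>lborel)"
    unfolding lborel_prod[symmetric] by (subst lborel.nn_integral_fst[symmetric]) auto
  also have "\<dots> = (\<integral>\<^sup>+ \<tau>. ennreal (exp (- (H * (\<tau> - A))\<^sup>2 / 2)) * ennreal (sqrt (2 * pi) / L) \<partial>lborel)"
    by (simp add: ennreal_mult' nn_integral_cmult nn_integral_gaussian[OF assms(2), simplified])
  also have "\<dots> = ennreal (sqrt (2 * pi) / H) * ennreal (sqrt (2 * pi) / L)"
    by (subst nn_integral_multc) (simp_all only: nn_integral_gaussian[OF assms(1)], simp)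
  also have "\<dots> = ennreal (2 * pi / (H * L))"
    using assms by (simp add: ennreal_mult'[symmetric])
  finally show ?thesis .
qed

lemma norm_packet: "norm (packet L A B (t, x)) = exp (- t\<^sup>2 / 2) * exp (- (x / L)\<^sup>2 / 2)"
  by (simp add: packet_def norm_mult)

text \<open>The modulations have modulus one, so the product has the same size wherever the two packets lie in
  frequency.\<close>

lemma L2_norm_packet_product:
  assumes "L > 0"
  shows "ennreal (sqrt (pi * L / 2)) \<le> L2_norm (\<lambda>z. packet L A B z * packet L A' B' z)"
proof (rule L2_norm_ge)
  have *: "(norm (packet L A B (t, x) * packet L A' B' (t, x)))\<^sup>2
      = exp (- (2 * (t - 0))\<^sup>2 / 2) * exp (- ((2 / L) * (x - 0))\<^sup>2 / 2)" for t x
    by (simp add: norm_mult norm_packet power2_eq_square exp_add[symmetric] algebra_simps)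
  have "(\<integral>\<^sup>+ z. ennreal ((norm (packet L A B z * packet L A' B' z))\<^sup>2) \<partial>lborel)
      = (\<integral>\<^sup>+ (t, x). ennreal (exp (- (2 * (t - 0))\<^sup>2 / 2) * exp (- ((2 / L) * (x - 0))\<^sup>2 / 2)) \<partial>lborel)"
    by (intro nn_integral_cong) (auto simp only: * split: prod.splits)
  also have "\<dots> = ennreal (2 * pi / (2 * (2 / L)))"
    using assms by (intro nn_integral_gaussian2) auto
  also have "2 * pi / (2 * (2 / L)) = (sqrt (pi * L / 2))\<^sup>2"
    using assms by simp
  finally show "ennreal ((sqrt (pi * L / 2))\<^sup>2)
      \<le> (\<integral>\<^sup>+ z. ennreal ((norm (packet L A B z * packet L A' B' z))\<^sup>2) \<partial>lborel)"
    by simp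
qed (use assms in auto)

section \<open>The weights near the cubic\<close>

lemma bracket_pos [simp]: "bracket x > 0" and bracket_ge_1: "bracket x \<ge> 1"
  by (auto simp: bracket_def)

lemma bracket_le_exp: "bracket x \<le> exp \<bar>x\<bar>"
  unfolding bracket_def by (rule exp_ge_add_one_self)

lemma bracket_add_le: "bracket (x + y) \<le> bracket x * bracket y"
proof -
  have "\<bar>x + y\<bar> \<le> \<bar>x\<bar> + \<bar>y\<bar>" "0 \<le> \<bar>x\<bar> * \<bar>y\<bar>"
    by auto
  then have "1 + \<bar>x + y\<bar> \<le> 1 + \<bar>x\<bar> + \<bar>y\<bar> + \<bar>x\<bar> * \<bar>y\<bar>"
    by linarith
  then show ?thesis by (simp add: bracket_def algebra_simps)
qed

lemma bracket_mono: "\<bar>x\<bar> \<le> \<bar>y\<bar> \<Longrightarrow> bracket x \<le> bracket y"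
  by (simp add: bracket_def)

text \<open>Peetre's inequality.  For negative \<open>p\<close> it is the case of positive exponents applied to
  \<open>x = (x + y) + (- y)\<close>.\<close>

lemma peetre:
  "bracket (x + y) powr p \<le> bracket x powr p * bracket y powr \<bar>p\<bar>"
proof (cases "p \<ge> 0")
  case True
  have "bracket (x + y) powr p \<le> (bracket x * bracket y) powr p"
    by (intro powr_mono2 True bracket_add_le) (simp add: less_imp_le)
  then show ?thesis using True by (simp add: powr_mult less_imp_le)
next
  case False
  have "bracket x \<le> bracket (x + y) * bracket y"
    using bracket_add_le[of "x + y" "-y"] by (simp add: bracket_def)
  then have "bracket x powr (-p) \<le> (bracket (x + y) * bracket y) powr (-p)"
    using False by (intro powr_mono2) (auto simp: less_imp_le)
  then have "bracket x powr (-p) \<le> bracket (x + y) powr (-p) * bracket y powr (-p)"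
    by (simp add: powr_mult less_imp_le)
  moreover have "\<bar>p\<bar> = - p" using False by simp
  moreover have "bracket x powr p > 0" "bracket y powr p > 0" "bracket (x + y) powr p > 0"
    using bracket_pos by (auto simp: less_imp_neq[THEN not_sym])
  ultimately show ?thesis
    by (simp add: powr_minus field_simps)
qed

lemma bracket_powr_le_exp:
  assumes "m \<ge> 0"
  shows "bracket x powr m \<le> exp (m * \<bar>x\<bar>)"
proof -
  have "bracket x powr m \<le> exp \<bar>x\<bar> powr m"
    using assms by (intro powr_mono2 bracket_le_exp) (auto simp: less_imp_le)
  then show ?thesis by (simp add: powr_def mult_ac)
qed

text \<open>Write \<open>\<xi> = M + \<delta>\<close> and \<open>\<eta> = N\<^sup>2 \<delta>\<close>.  In \<open>\<xi>\<^sup>3 - M\<^sup>3 = 3 M\<^sup>2 \<delta> + 3 M \<delta>\<^sup>2 + \<delta>\<^sup>3\<close> the linear term is at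
  most \<open>3 \<bar>\<eta>\<bar>\<close>, since \<open>M \<le> N\<close>; this is what dictates the width \<open>N\<^sup>-\<^sup>2\<close> of the packets.  The other terms
  are dominated by the higher powers of \<open>\<bar>\<eta>\<bar>\<close>, so the sum is at most \<open>(1 + \<bar>\<eta>\<bar>)\<^sup>3\<close>.\<close>

lemma cubic_modulation:
  assumes "N \<ge> 1" "0 \<le> M" "M \<le> N"
  shows "bracket (\<tau> - a * \<xi> ^ 3)
    \<le> (1 + \<bar>a\<bar>) * (bracket (\<tau> - a * M ^ 3) * bracket (N\<^sup>2 * (\<xi> - M)) ^ 3)"
proof -
  define \<delta> where "\<delta> = \<xi> - M"
  define \<eta> where "\<eta> = N\<^sup>2 * (\<xi> - M)"
  have \<eta>: "\<bar>\<eta>\<bar> = N\<^sup>2 * \<bar>\<delta>\<bar>" by (simp add: \<eta>_def \<delta>_def abs_mult)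
  have N2: "1 \<le> N\<^sup>2" using assms(1) by simp
  have \<delta>: "\<bar>\<delta>\<bar> \<le> \<bar>\<eta>\<bar>"
    unfolding \<eta> using mult_right_mono[OF N2, of "\<bar>\<delta>\<bar>"] by simp
  have 1: "\<bar>M\<^sup>2 * \<delta>\<bar> \<le> \<bar>\<eta>\<bar>"
    unfolding \<eta> using assms by (simp add: abs_mult mult_right_mono power_mono)
  have "M \<le> N\<^sup>2" using assms(1,3) self_le_power[of N 2] by linarith
  then have "\<bar>M * \<delta>\<bar> \<le> \<bar>\<eta>\<bar>"
    unfolding \<eta> using assms(2) by (simp add: abs_mult mult_right_mono)
  then have 2: "\<bar>M * \<delta>\<^sup>2\<bar> \<le> \<bar>\<eta>\<bar>\<^sup>2"
    using mult_mono[of "\<bar>M * \<delta>\<bar>" "\<bar>\<eta>\<bar>" "\<bar>\<delta>\<bar>" "\<bar>\<eta>\<bar>"] \<delta>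
    by (simp add: abs_mult power2_eq_square mult_ac)
  have 3: "\<bar>\<delta> ^ 3\<bar> \<le> \<bar>\<eta>\<bar> ^ 3"
    using power_mono[OF \<delta>, of 3] by (simp add: power_abs)
  have "\<xi> ^ 3 - M ^ 3 = 3 * (M\<^sup>2 * \<delta>) + 3 * (M * \<delta>\<^sup>2) + \<delta> ^ 3"
    by (simp add: \<delta>_def power2_eq_square power3_eq_cube algebra_simps)
  then have "\<bar>\<xi> ^ 3 - M ^ 3\<bar> \<le> 3 * \<bar>\<eta>\<bar> + 3 * \<bar>\<eta>\<bar>\<^sup>2 + \<bar>\<eta>\<bar> ^ 3"
    using 1 2 3 by linarith
  also have "\<dots> \<le> bracket \<eta> ^ 3"
    by (simp add: bracket_def power2_eq_square power3_eq_cube algebra_simps)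
  finally have cube: "\<bar>\<xi> ^ 3 - M ^ 3\<bar> \<le> bracket \<eta> ^ 3" .
  have "\<tau> - a * \<xi> ^ 3 = (\<tau> - a * M ^ 3) + (- (a * (\<xi> ^ 3 - M ^ 3)))"
    by (simp add: algebra_simps)
  then have "bracket (\<tau> - a * \<xi> ^ 3) \<le> bracket (\<tau> - a * M ^ 3) * bracket (- (a * (\<xi> ^ 3 - M ^ 3)))"
    by (metis bracket_add_le)
  also have "bracket (- (a * (\<xi> ^ 3 - M ^ 3))) \<le> (1 + \<bar>a\<bar>) * bracket \<eta> ^ 3"
  proof -
    have "1 \<le> bracket \<eta> ^ 3"
      using bracket_ge_1 by simp
    then show ?thesis
      using mult_left_mono[OF cube, of "\<bar>a\<bar>"]
      by (simp add: bracket_def[of "- _"] abs_mult distrib_right)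
  qed
  finally show ?thesis
    by (simp add: \<eta>_def mult_left_mono less_imp_le mult_ac)
qed

text \<open>In the coordinates \<open>\<sigma> = \<tau> - a M\<^sup>3\<close> and \<open>\<eta> = N\<^sup>2 (\<xi> - M)\<close>, adapted to the packet, the weight exceeds
  \<open>\<langle>M\<rangle>\<^sup>p\<close> by a factor that grows at most polynomially, uniformly in \<open>N\<close> and \<open>M\<close>.  The transform of the
  packet decays like \<open>exp (- \<sigma>\<^sup>2 / 2 - \<eta>\<^sup>2 / 2)\<close>, so half of that decay may be spent on this factor.\<close>

lemma weight_le_gaussian:
  fixes p a b :: real
  obtains K where "K > 0"
    "\<And>N M \<tau> \<xi>. N \<ge> 1 \<Longrightarrow> 0 \<le> M \<Longrightarrow> M \<le> N \<Longrightarrow>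
       bracket \<xi> powr p * bracket (\<tau> - a * \<xi> ^ 3) powr b
       \<le> K * bracket M powr p * exp ((\<tau> - a * M ^ 3)\<^sup>2 / 4 + (N\<^sup>2 * (\<xi> - M))\<^sup>2 / 4)"
proof
  define l where "l = \<bar>p\<bar> + 3 * \<bar>b\<bar>"
  define K where "K = (1 + \<bar>a\<bar>) powr \<bar>b\<bar> * exp (b\<^sup>2 + l\<^sup>2)"
  show "K > 0" by (simp add: K_def add_pos_nonneg)
  fix N M \<tau> \<xi> :: real
  assume N: "N \<ge> 1" and M: "0 \<le> M" "M \<le> N"
  define \<sigma> where "\<sigma> = \<tau> - a * M ^ 3"
  define \<eta> where "\<eta> = N\<^sup>2 * (\<xi> - M)"
  have "1 \<le> N\<^sup>2" using N by simp
  then have "\<bar>\<xi> - M\<bar> \<le> \<bar>\<eta>\<bar>"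
    using mult_right_mono[of 1 "N\<^sup>2" "\<bar>\<xi> - M\<bar>"] by (simp add: \<eta>_def abs_mult)
  have "bracket \<xi> powr p \<le> bracket M powr p * bracket (\<xi> - M) powr \<bar>p\<bar>"
    using peetre[of M "\<xi> - M" p] by simp
  also have "\<dots> \<le> bracket M powr p * bracket \<eta> powr \<bar>p\<bar>"
    by (intro mult_left_mono powr_mono2 bracket_mono) (use \<open>\<bar>\<xi> - M\<bar> \<le> \<bar>\<eta>\<bar>\<close> in \<open>auto simp: less_imp_le\<close>)
  also have "\<dots> \<le> bracket M powr p * exp (\<bar>p\<bar> * \<bar>\<eta>\<bar>)"
    by (intro mult_left_mono bracket_powr_le_exp) auto
  finally have freq: "bracket \<xi> powr p \<le> bracket M powr p * exp (\<bar>p\<bar> * \<bar>\<eta>\<bar>)" .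
  \<comment> \<open>The bracket is at least one, so a negative exponent only helps.\<close>
  have "bracket (\<tau> - a * \<xi> ^ 3) powr b \<le> bracket (\<tau> - a * \<xi> ^ 3) powr \<bar>b\<bar>"
    using bracket_ge_1 by (intro powr_mono) auto
  also have "\<dots> \<le> ((1 + \<bar>a\<bar>) * (bracket \<sigma> * bracket \<eta> ^ 3)) powr \<bar>b\<bar>"
    unfolding \<sigma>_def \<eta>_def
    by (intro powr_mono2 cubic_modulation N M) (auto simp: less_imp_le)
  also have "\<dots> = (1 + \<bar>a\<bar>) powr \<bar>b\<bar> * (bracket \<sigma> powr \<bar>b\<bar> * bracket \<eta> powr (3 * \<bar>b\<bar>))"
    by (simp add: powr_mult less_imp_le powr_powr[symmetric])
  also have "\<dots> \<le> (1 + \<bar>a\<bar>) powr \<bar>b\<bar> * (exp (\<bar>b\<bar> * \<bar>\<sigma>\<bar>) * exp (3 * \<bar>b\<bar> * \<bar>\<eta>\<bar>))"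
    by (intro mult_left_mono mult_mono bracket_powr_le_exp) auto
  finally have mod: "bracket (\<tau> - a * \<xi> ^ 3) powr b \<le> \<dots>" .
  have "bracket \<xi> powr p * bracket (\<tau> - a * \<xi> ^ 3) powr b
      \<le> (bracket M powr p * exp (\<bar>p\<bar> * \<bar>\<eta>\<bar>))
        * ((1 + \<bar>a\<bar>) powr \<bar>b\<bar> * (exp (\<bar>b\<bar> * \<bar>\<sigma>\<bar>) * exp (3 * \<bar>b\<bar> * \<bar>\<eta>\<bar>)))"
    by (intro mult_mono freq mod) auto
  also have "\<dots> = (1 + \<bar>a\<bar>) powr \<bar>b\<bar> * bracket M powr p * exp (\<bar>b\<bar> * \<bar>\<sigma>\<bar> + l * \<bar>\<eta>\<bar>)"
    by (simp add: l_def exp_add[symmetric] algebra_simps)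
  also have "\<dots> \<le> (1 + \<bar>a\<bar>) powr \<bar>b\<bar> * bracket M powr p * exp (b\<^sup>2 + l\<^sup>2 + (\<sigma>\<^sup>2 / 4 + \<eta>\<^sup>2 / 4))"
    using linear_le_square[of "1/4" "\<bar>b\<bar>" "\<bar>\<sigma>\<bar>"] linear_le_square[of "1/4" l "\<bar>\<eta>\<bar>"]
    by (intro mult_left_mono) auto
  also have "\<dots> = K * bracket M powr p * exp (\<sigma>\<^sup>2 / 4 + \<eta>\<^sup>2 / 4)"
    by (simp add: K_def exp_add mult_ac)
  finally show "bracket \<xi> powr p * bracket (\<tau> - a * \<xi> ^ 3) powr b
       \<le> K * bracket M powr p * exp ((\<tau> - a * M ^ 3)\<^sup>2 / 4 + (N\<^sup>2 * (\<xi> - M))\<^sup>2 / 4)"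
    by (simp add: \<sigma>_def \<eta>_def)
qed

section \<open>Failure of the bilinear estimate\<close>

text \<open>The transform has height \<open>2 * pi * N\<^sup>2\<close> on a region of area comparable to \<open>N\<^sup>-\<^sup>2\<close>, which accounts for the
  factor \<open>N\<close>; the weight contributes \<open>\<langle>M\<rangle>\<^sup>p\<close>.\<close>

lemma X_norm_packet:
  fixes p a b :: real
  obtains C where "C > 0"
    "\<And>N M. N \<ge> 1 \<Longrightarrow> 0 \<le> M \<Longrightarrow> M \<le> N \<Longrightarrow>
       X_norm a p b (packet (N\<^sup>2) (a * M ^ 3) M) \<le> ennreal (C * N * bracket M powr p)"
proof -
  obtain K where K: "K > 0"
    "\<And>N M \<tau> \<xi>. N \<ge> 1 \<Longrightarrow> 0 \<le> M \<Longrightarrow> M \<le> N \<Longrightarrow>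
       bracket \<xi> powr p * bracket (\<tau> - a * \<xi> ^ 3) powr b
       \<le> K * bracket M powr p * exp ((\<tau> - a * M ^ 3)\<^sup>2 / 4 + (N\<^sup>2 * (\<xi> - M))\<^sup>2 / 4)"
    using weight_le_gaussian[of p a b] by blast
  define C where "C = 2 * pi * K * sqrt (2 * pi)"
  have "C > 0" using K by (simp add: C_def)
  moreover have "X_norm a p b (packet (N\<^sup>2) (a * M ^ 3) M) \<le> ennreal (C * N * bracket M powr p)"
    if N: "N \<ge> 1" and M: "0 \<le> M" "M \<le> N" for N M
    unfolding X_norm_def
  proof (rule L2_norm_le)
    let ?u = "packet (N\<^sup>2) (a * M ^ 3) M"
    let ?F = "\<lambda>(\<tau>, \<xi>). complex_of_real (bracket \<xi> powr p * bracket (\<tau> - a * \<xi> ^ 3) powr b)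
                          * fourier ?u (\<tau>, \<xi>)"
    define D where "D = 2 * pi * K * N\<^sup>2 * bracket M powr p"
    have L: "N\<^sup>2 > 0" using N by simp
    have "(norm (?F (\<tau>, \<xi>)))\<^sup>2 \<le> D\<^sup>2 * (exp (- (\<tau> - a * M ^ 3)\<^sup>2 / 2) * exp (- (N\<^sup>2 * (\<xi> - M))\<^sup>2 / 2))"
      for \<tau> \<xi>
    proof -
      define \<sigma> where "\<sigma> = \<tau> - a * M ^ 3"
      define \<eta> where "\<eta> = N\<^sup>2 * (\<xi> - M)"
      have "norm (?F (\<tau>, \<xi>)) = (bracket \<xi> powr p * bracket (\<tau> - a * \<xi> ^ 3) powr b)
          * (2 * pi * N\<^sup>2 * exp (- \<sigma>\<^sup>2 / 2) * exp (- \<eta>\<^sup>2 / 2))"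
        by (simp add: fourier_packet[OF L] norm_mult norm_power \<sigma>_def \<eta>_def)
      also have "\<dots> \<le> (K * bracket M powr p * exp (\<sigma>\<^sup>2 / 4 + \<eta>\<^sup>2 / 4))
          * (2 * pi * N\<^sup>2 * exp (- \<sigma>\<^sup>2 / 2) * exp (- \<eta>\<^sup>2 / 2))"
        unfolding \<sigma>_def \<eta>_def by (intro mult_right_mono K N M) auto
      also have "\<dots> = D * (exp (\<sigma>\<^sup>2 / 4 + \<eta>\<^sup>2 / 4) * (exp (- \<sigma>\<^sup>2 / 2) * exp (- \<eta>\<^sup>2 / 2)))"
        by (simp add: D_def)
      also have "\<dots> = D * exp (- \<sigma>\<^sup>2 / 4 - \<eta>\<^sup>2 / 4)"
        by (simp add: exp_add[symmetric])
      finally have "(norm (?F (\<tau>, \<xi>)))\<^sup>2 \<le> (D * exp (- \<sigma>\<^sup>2 / 4 - \<eta>\<^sup>2 / 4))\<^sup>2"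
        by (intro power_mono) auto
      also have "\<dots> = D\<^sup>2 * (exp (- \<sigma>\<^sup>2 / 2) * exp (- \<eta>\<^sup>2 / 2))"
        by (simp add: power_mult_distrib exp_double[symmetric] exp_add[symmetric])
      finally show ?thesis by (simp add: \<sigma>_def \<eta>_def)
    qed
    then have "(\<integral>\<^sup>+ z. ennreal ((norm (?F z))\<^sup>2) \<partial>lborel)
      \<le> (\<integral>\<^sup>+ z. ennreal (D\<^sup>2) * (case z of (\<tau>, \<xi>) \<Rightarrow>
           ennreal (exp (- (\<tau> - a * M ^ 3)\<^sup>2 / 2) * exp (- (N\<^sup>2 * (\<xi> - M))\<^sup>2 / 2))) \<partial>lborel)"
      by (intro nn_integral_mono)
        (auto simp only: split_paired_all prod.case ennreal_mult'[symmetric] zero_le_power2 intro!: ennreal_leI)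
    also have "\<dots> = ennreal (D\<^sup>2) * ennreal (2 * pi / N\<^sup>2)"
      using nn_integral_gaussian2[OF zero_less_one L, of "a * M ^ 3" M]
      by (subst nn_integral_cmult) (simp_all add: lborel_prod[symmetric])
    also have "\<dots> = ennreal ((C * N * bracket M powr p)\<^sup>2)"
      using N by (simp add: ennreal_mult'[symmetric] C_def D_def field_simps power2_eq_square)
    finally show "(\<integral>\<^sup>+ z. ennreal ((norm (?F z))\<^sup>2) \<partial>lborel) \<le> ennreal ((C * N * bracket M powr p)\<^sup>2)" .
  qed (use \<open>C > 0\<close> N in auto)
  ultimately show ?thesis by (rule that)
qed

text \<open>Obtained by testing the estimate with a packet at frequency \<open>N\<close> against one at frequency \<open>M\<close>, both
  of spatial width \<open>N\<^sup>2\<close>.\<close>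

lemma bilinear_estimate_necessary:
  fixes a a' b b' p q :: real
  assumes "L2_bilinear_estimate (X_norm a p b) (X_norm a' q b')"
  shows "\<exists>C. \<forall>N M. N \<ge> 1 \<longrightarrow> 0 \<le> M \<longrightarrow> M \<le> N \<longrightarrow> 1 \<le> C * (N * bracket N powr p * bracket M powr q)"
proof -
  obtain C where C: "C > 0" "\<And>u v. schwartz u \<Longrightarrow> schwartz v \<Longrightarrow>
     L2_norm (\<lambda>z. u z * v z) \<le> ennreal C * (X_norm a p b u * X_norm a' q b' v)"
    using assms unfolding L2_bilinear_estimate_def by blast
  obtain C1 where C1: "C1 > 0" "\<And>N M. N \<ge> 1 \<Longrightarrow> 0 \<le> M \<Longrightarrow> M \<le> N \<Longrightarrow>
       X_norm a p b (packet (N\<^sup>2) (a * M ^ 3) M) \<le> ennreal (C1 * N * bracket M powr p)"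
    using X_norm_packet[of a p b] by blast
  obtain C2 where C2: "C2 > 0" "\<And>N M. N \<ge> 1 \<Longrightarrow> 0 \<le> M \<Longrightarrow> M \<le> N \<Longrightarrow>
       X_norm a' q b' (packet (N\<^sup>2) (a' * M ^ 3) M) \<le> ennreal (C2 * N * bracket M powr q)"
    using X_norm_packet[of a' q b'] by blast
  define c where "c = sqrt (pi / 2)"
  have "c > 0" by (simp add: c_def)
  have "1 \<le> (C * C1 * C2 / c) * (N * bracket N powr p * bracket M powr q)"
    if N: "N \<ge> 1" and M: "0 \<le> M" "M \<le> N" for N M
  proof -
    let ?u = "packet (N\<^sup>2) (a * N ^ 3) N" and ?v = "packet (N\<^sup>2) (a' * M ^ 3) M"
    have L: "N\<^sup>2 > 0" using N by simp
    have "ennreal (c * N) = ennreal (sqrt (pi * N\<^sup>2 / 2))"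
      using N by (simp add: c_def real_sqrt_mult real_sqrt_divide)
    also have "\<dots> \<le> L2_norm (\<lambda>z. ?u z * ?v z)"
      by (rule L2_norm_packet_product[OF L])
    also have "\<dots> \<le> ennreal C * (X_norm a p b ?u * X_norm a' q b' ?v)"
      by (intro C schwartz_packet L)
    also have "\<dots> \<le> ennreal C * (ennreal (C1 * N * bracket N powr p) * ennreal (C2 * N * bracket M powr q))"
      using N M by (intro mult_left_mono mult_mono C1 C2) auto
    also have "\<dots> = ennreal (C * ((C1 * N * bracket N powr p) * (C2 * N * bracket M powr q)))"
      using N C(1) C1(1) C2(1) by (simp add: ennreal_mult'[symmetric])
    finally have "c * N \<le> C * ((C1 * N * bracket N powr p) * (C2 * N * bracket M powr q))"
      using N C(1) C1(1) C2(1) by (subst (asm) ennreal_le_iff) auto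
    then have "N * c \<le> N * (C * C1 * C2 * (N * bracket N powr p * bracket M powr q))"
      by (simp add: mult_ac)
    then show ?thesis
      using N \<open>c > 0\<close> by (simp add: field_simps)
  qed
  then show ?thesis by blast
qed

lemma bilinear_estimate_fails:
  fixes a a' b b' p q :: real
  assumes "p < -1 \<or> p + q < -1"
  shows "\<not> L2_bilinear_estimate (X_norm a p b) (X_norm a' q b')"
proof
  assume "L2_bilinear_estimate (X_norm a p b) (X_norm a' q b')"
  then obtain C where C: "\<And>N M. N \<ge> 1 \<Longrightarrow> 0 \<le> M \<Longrightarrow> M \<le> N \<Longrightarrow>
      1 \<le> C * (N * bracket N powr p * bracket M powr q)"
    using bilinear_estimate_necessary by meson
  \<comment> \<open>Taking \<open>M = 0\<close> gives \<open>r = p\<close>, and \<open>M = N\<close> gives \<open>r = p + q\<close>.\<close>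
  obtain r where r: "r < -1" "\<And>N. N \<ge> 1 \<Longrightarrow> 1 \<le> C * (N * bracket N powr r)"
  proof (cases "p < -1")
    case True
    show ?thesis
      by (rule that[OF True]) (use C[of _ 0] in \<open>simp add: bracket_def\<close>)
  next
    case False
    with assms have pq: "p + q < -1" by simp
    show ?thesis
    proof (rule that[OF pq])
      fix N :: real assume "N \<ge> 1"
      then show "1 \<le> C * (N * bracket N powr (p + q))"
        using C[of N N] by (simp add: powr_add mult_ac)
    qed
  qed
  have "((\<lambda>N. C * (N * (1 + N) powr r)) \<longlongrightarrow> 0) at_top"
    using r(1) by real_asymp
  then have "\<forall>\<^sub>F N in at_top. C * (N * (1 + N) powr r) < 1"
    by (rule order_tendstoD) simp
  moreover have "\<forall>\<^sub>F N in at_top. (N::real) \<ge> 1"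
    by (rule eventually_ge_at_top)
  ultimately have "\<forall>\<^sub>F N::real in at_top. False"
  proof eventually_elim
    case (elim N)
    then show False using r(2)[of N] by (simp add: bracket_def)
  qed
  then show False by simp
qed

theorem proposition6p1:
  fixes \<alpha> s k \<epsilon> :: real
  assumes "\<alpha> \<noteq> 0" and "\<alpha> \<noteq> 1" and "\<epsilon> > 0"
  shows "(s - k > 1/2 \<or> k < -1/2 \<longrightarrow>
            \<not> L2_bilinear_estimate (X_norm \<alpha> (k - s - 1/2) (1/2 + \<epsilon>)) (X_norm 1 s (1/2 + \<epsilon>))) \<and>
         (k - s > 1/2 \<or> s < -1/2 \<longrightarrow>
            \<not> L2_bilinear_estimate (X_norm 1 (s - k - 1/2) (1/2 + \<epsilon>)) (X_norm \<alpha> k (1/2 + \<epsilon>)))"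
  by (intro conjI impI bilinear_estimate_fails) auto

end
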